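(* For $1\le p\le2$ we have $$(l^1(\mathcal U),l^2(\mathcal U))_{\theta,p}=l^p(\mathcal U),\qquad (l^1(\mathcal V),l^2(\mathcal V))_{\theta,p}=l^p(\mathcal V),$$ where $0<\theta<1$ and $p=\frac{2}{2-\theta}$.
   Context: $(\cdot,\cdot)_{\theta,p}$ denotes the real interpolation space, and equalities of spaces are understood with equivalence of norms. $\mathcal H$ is a separable complex Hilbert space with inner product $(\cdot,\cdot)_{\mathcal H}$. $I$ is a discrete (countable) index set. $\mathcal U=\{u_\xi\}_{\xi\in I}$ is a Riesz basis of $\mathcal H$, and $\mathcal V=\{v_\xi\}_{\xi\in I}\subset\mathcal H$ is the system biorthogonal to $\mathcal U$: $(u_\xi,v_\eta)_{\mathcal H}=\delta_{\xi\eta}$; then $\mathcal V$ is also a Riesz basis of $\mathcal H$. Standing assumptions on $\mathcal H^p$: $\{\mathcal H^p\}_{1\le p\le\infty}$ is a family of Banach spaces with norms $\|\cdot\|_{\mathcal H^p}$ such that $\mathcal H^p\subseteq\mathcal H$, $\mathcal H^2=\mathcal H$, and $|(x,y)_{\mathcal H}|\le\|x\|_{\mathcal H^p}\|y\|_{\mathcal H^q}$ for all $x\in\mathcal H^p$, $y\in\mathcal H^q$, $1\le p\le\infty$, $\frac1p+\frac1q=1$. They satisfy the real interpolation properties $(\mathcal H^1,\mathcal H^2)_{\theta,p}=\mathcal H^p$ for $0<\theta<1$, $\frac1p=1-\frac\theta2$, and $(\mathcal H^2,\mathcal H^\infty)_{\theta,p}=\mathcal H^p$ for $0<\theta<1$,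 $\frac1p=\frac{1-\theta}2$. Also $\mathcal U\subset\mathcal H^p$ and $\mathcal V\subset\mathcal H^p$ for all $p\in[1,\infty]$. For $1\le p\le2$, $l^p(\mathcal U)$ is the space of all $a:I\to\mathbb C$ with $$\|a\|_{l^p(\mathcal U)}=\Big(\sum_{\xi\in I}|a(\xi)|^p\|u_\xi\|_{\mathcal H^\infty}^{2-p}\Big)^{1/p}<\infty,$$ and $l^p(\mathcal V)$ is the space of all $b:I\to\mathbb C$ with $$\|b\|_{l^p(\mathcal V)}=\Big(\sum_{\xi\in I}|b(\xi)|^p\|v_\xi\|_{\mathcal H^\infty}^{2-p}\Big)^{1/p}<\infty.$$ *)

theory Defs
  imports "HOL-Analysis.Analysis" "HOL-Library.Function_Algebras"
begin

section \<open>Complex Hilbert spaces and Riesz bases\<close>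

text \<open>The inner product is linear in its first argument.\<close>

class complex_hilbert = banach +
  fixes scaleC :: "complex \<Rightarrow> 'a \<Rightarrow> 'a"  (infixr "*\<^sub>C" 75)
    and cinner :: "'a \<Rightarrow> 'a \<Rightarrow> complex"
  assumes scaleR_scaleC: "r *\<^sub>R x = complex_of_real r *\<^sub>C x"
    and scaleC_add_right: "c *\<^sub>C (x + y) = c *\<^sub>C x + c *\<^sub>C y"
    and scaleC_add_left: "(c + d) *\<^sub>C x = c *\<^sub>C x + d *\<^sub>C x"
    and scaleC_scaleC: "c *\<^sub>C d *\<^sub>C x = (c * d) *\<^sub>C x"
    and scaleC_one: "1 *\<^sub>C x = x"
    and cinner_commute: "cinner x y = cnj (cinner y x)"
    and cinner_add_left: "cinner (x + y) z = cinner x z + cinner y z"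
    and cinner_scaleC_left: "cinner (c *\<^sub>C x) y = c * cinner x y"
    and cinner_self: "cinner x x = complex_of_real ((norm x)\<^sup>2)"

definition orthonormal_basis :: "('i \<Rightarrow> 'h::complex_hilbert) \<Rightarrow> bool" where
  "orthonormal_basis e \<longleftrightarrow>
     (\<forall>\<xi> \<eta>. cinner (e \<xi>) (e \<eta>) = (if \<xi> = \<eta> then 1 else 0)) \<and>
     closure (module.span scaleC (range e)) = UNIV"

text \<open>A Riesz basis is the image of an orthonormal basis under a bounded bijective
  complex-linear operator; its inverse is then bounded by the open mapping theorem.\<close>

definition riesz_basis :: "('i \<Rightarrow> 'h::complex_hilbert) \<Rightarrow> bool" where
  "riesz_basis u \<longleftrightarrow>
     (\<exists>(e :: 'i \<Rightarrow> 'h) (T :: 'h \<Rightarrow> 'h). orthonormal_basis e \<and>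
            bounded_linear T \<and> (\<forall>c x. T (c *\<^sub>C x) = c *\<^sub>C T x) \<and> bij T \<and>
            (\<forall>\<xi>. u \<xi> = T (e \<xi>)))"

definition biorthogonal :: "('i \<Rightarrow> 'h::complex_hilbert) \<Rightarrow> ('i \<Rightarrow> 'h) \<Rightarrow> bool" where
  "biorthogonal u v \<longleftrightarrow> (\<forall>\<xi> \<eta>. cinner (u \<xi>) (v \<eta>) = (if \<xi> = \<eta> then 1 else 0))"

section \<open>Spaces with their own norm inside an ambient vector space\<close>

text \<open>The values of \<open>nrm X\<close> outside \<open>vecs X\<close> carry no meaning.\<close>

record 'a nspace =
  vecs :: "'a set"
  nrm :: "'a \<Rightarrow> real"

definition complex_banach_space :: "('h::complex_hilbert) nspace \<Rightarrow> bool" where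
  "complex_banach_space X \<longleftrightarrow>
     0 \<in> vecs X \<and>
     (\<forall>x\<in>vecs X. \<forall>y\<in>vecs X. x + y \<in> vecs X) \<and>
     (\<forall>c. \<forall>x\<in>vecs X. c *\<^sub>C x \<in> vecs X) \<and>
     (\<forall>x\<in>vecs X. 0 \<le> nrm X x \<and> (nrm X x = 0 \<longleftrightarrow> x = 0)) \<and>
     (\<forall>x\<in>vecs X. \<forall>y\<in>vecs X. nrm X (x + y) \<le> nrm X x + nrm X y) \<and>
     (\<forall>c. \<forall>x\<in>vecs X. nrm X (c *\<^sub>C x) = cmod c * nrm X x) \<and>
     (\<forall>s. (\<forall>n. s n \<in> vecs X) \<and>
          (\<forall>\<epsilon>>0. \<exists>N. \<forall>m\<ge>N. \<forall>n\<ge>N. nrm X (s m - s n) < \<epsilon>) \<longrightarrow>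
          (\<exists>l\<in>vecs X. (\<lambda>n::nat. nrm X (s n - l)) \<longlonglongrightarrow> 0))"

text \<open>Equality of spaces with equivalence of norms.\<close>

definition same_space :: "'a nspace \<Rightarrow> 'a nspace \<Rightarrow> bool"  (infix "\<approx>" 50) where
  "X \<approx> Y \<longleftrightarrow> vecs X = vecs Y \<and>
     (\<exists>c>0. \<exists>C>0. \<forall>x\<in>vecs X. c * nrm X x \<le> nrm Y x \<and> nrm Y x \<le> C * nrm X x)"

section \<open>Real interpolation (Peetre's K-method)\<close>

definition sum_space :: "('a::ab_group_add) nspace \<Rightarrow> 'a nspace \<Rightarrow> 'a set" where
  "sum_space X Y = {x + y | x y. x \<in> vecs X \<and> y \<in> vecs Y}"

definition K_functional ::
  "('a::ab_group_add) nspace \<Rightarrow> 'a nspace \<Rightarrow> real \<Rightarrow> 'a \<Rightarrow> real" where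
  "K_functional X Y t z =
     Inf {nrm X x + t * nrm Y y | x y. x \<in> vecs X \<and> y \<in> vecs Y \<and> z = x + y}"

definition interp_integral ::
  "real \<Rightarrow> real \<Rightarrow> ('a::ab_group_add) nspace \<Rightarrow> 'a nspace \<Rightarrow> 'a \<Rightarrow> ennreal" where
  "interp_integral \<theta> q X Y z =
     (\<integral>\<^sup>+t\<in>{0<..}. ennreal ((t powr (-\<theta>) * K_functional X Y t z) powr q / t) \<partial>lborel)"

text \<open>The space $(X,Y)_{\theta,q}$ for $0 < \theta < 1$ and finite exponent $1 \le q < \infty$.\<close>

definition real_interp ::
  "real \<Rightarrow> real \<Rightarrow> ('a::ab_group_add) nspace \<Rightarrow> 'a nspace \<Rightarrow> 'a nspace" where
  "real_interp \<theta> q X Y =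
     \<lparr>vecs = {z \<in> sum_space X Y. interp_integral \<theta> q X Y z < \<infinity>},
      nrm = (\<lambda>z. enn2real (interp_integral \<theta> q X Y z) powr (1 / q))\<rparr>"

section \<open>The sequence spaces\<close>

text \<open>\<open>lp_space p Hinf u\<close> is $l^p(\mathcal U)$ for $1 \le p \le 2$, where \<open>Hinf\<close> is
  $\mathcal H^\infty$. Since $u_\xi \neq 0$ for a Riesz basis, the convention
  \<open>0 powr 0 = 0\<close> does not affect the weight at \<open>p = 2\<close>.\<close>

definition lp_space :: "real \<Rightarrow> 'h nspace \<Rightarrow> ('i \<Rightarrow> 'h) \<Rightarrow> ('i \<Rightarrow> complex) nspace" where
  "lp_space p Hinf u =
     \<lparr>vecs = {a. (\<lambda>\<xi>. cmod (a \<xi>) powr p * nrm Hinf (u \<xi>) powr (2 - p)) summable_on UNIV},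
      nrm = (\<lambda>a. (\<Sum>\<^sub>\<infinity>\<xi>. cmod (a \<xi>) powr p * nrm Hinf (u \<xi>) powr (2 - p)) powr (1 / p))\<rparr>"

end

theory Submission
  imports Defs
begin

text \<open>Write \<open>w \<xi>\<close> for the weight and let \<open>k(s) = \<Sum> min(\<bar>a \<xi>\<bar> w \<xi>, s \<bar>a \<xi>\<bar>\<^sup>2)\<close>, which is
  comparable to the infimum of \<open>\<parallel>x\<parallel>\<^sub>1 + s \<parallel>y\<parallel>\<^sub>2\<^sup>2\<close> over all splittings \<open>a = x + y\<close>.
  Being additive over the index set, it integrates termwise: \<open>\<integral> s\<^bsup>-p\<^esup> k(s) ds\<close> is a constant multiple
  of \<open>\<Sum> \<bar>a \<xi>\<bar>\<^bsup>p\<^esup> w \<xi>\<^bsup>2-p\<^esup>\<close>. On the other hand \<open>K(t)\<close> and \<open>k(s)\<close> are comparable when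
  \<open>t\<^sup>2\<close> and \<open>s k(s)\<close> are, and then \<open>(t\<^bsup>-\<theta>\<^esup> K(t))\<^bsup>p\<^esup>\<close> and \<open>s\<^bsup>1-p\<^esup> k(s)\<close> are comparable too.
  The substitution \<open>t = \<surd>(s k(s))\<close> is not smooth; it is replaced by an application of Tonelli's theorem
  to a band around its graph, whose sections have bounded logarithmic length.\<close>

section \<open>Comparison of integrals along a curve of moderate growth\<close>

text \<open>Extension by 0 to the nonpositive half-line keeps the function monotone on the whole
  line, and monotone functions are Borel.\<close>

lemma borel_measurable_mono_pos:
  fixes f :: "real \<Rightarrow> real"
  assumes "\<And>t. 0 < t \<Longrightarrow> 0 \<le> f t" "\<And>s t. 0 < s \<Longrightarrow> s \<le> t \<Longrightarrow> f s \<le> f t"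
  shows "(\<lambda>t. if 0 < t then f t else 0) \<in> borel_measurable borel"
  by (rule borel_measurable_mono) (auto simp: mono_def assms)

lemma nn_integral_inverse_Icc:
  fixes a b :: real
  assumes "0 < a" "a \<le> b"
  shows "(\<integral>\<^sup>+t. ennreal (1 / t) * indicator {a..b} t \<partial>lborel) = ennreal (ln (b / a))"
proof -
  have "(\<integral>\<^sup>+t. ennreal (1 / t) * indicator {a..b} t \<partial>lborel) = ennreal (ln b - ln a)"
    by (rule nn_integral_FTC_Icc) (use assms in \<open>auto intro!: DERIV_ln_divide[THEN DERIV_subset]\<close>)
  then show ?thesis using assms by (simp add: ln_div)
qed

text \<open>Instantiated with \<open>\<phi> s = sqrt (s * k a s)\<close>. In logarithmic coordinates
  the slopes of the graph lie between 1/2 and 1.\<close>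

locale half_power_growth =
  fixes \<phi> :: "real \<Rightarrow> real"
  assumes pos: "0 < s \<Longrightarrow> 0 < \<phi> s"
    and growth_lower: "0 < s \<Longrightarrow> s \<le> t \<Longrightarrow> \<phi> s * sqrt (t / s) \<le> \<phi> t"
    and growth_upper: "0 < s \<Longrightarrow> s \<le> t \<Longrightarrow> \<phi> t \<le> \<phi> s * (t / s)"
begin

text \<open>The graph of \<open>\<phi>\<close>, thickened to the right by the factor 2. Measured by
  \<open>ds / s\<close> and \<open>dt / t\<close>, its sections in both directions have length
  comparable to \<open>ln 2\<close>, so integration over the band replaces the substitution
  \<open>t = \<phi> s\<close>.\<close>

definition band :: "(real \<times> real) set" where
  "band = {(s, t). 0 < s \<and> \<phi> (s / 2) \<le> t \<and> t \<le> \<phi> s}"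

lemma strictly_increasing: "0 < s \<Longrightarrow> s < t \<Longrightarrow> \<phi> s < \<phi> t"
proof -
  assume st: "0 < s" "s < t"
  have "1 < sqrt (t / s)" using st by simp
  then have "\<phi> s * 1 < \<phi> s * sqrt (t / s)"
    using pos st(1) by (intro mult_strict_left_mono) auto
  also have "\<dots> \<le> \<phi> t" using growth_lower st by simp
  finally show ?thesis by simp
qed

lemma increasing: "0 < s \<Longrightarrow> s \<le> t \<Longrightarrow> \<phi> s \<le> \<phi> t"
  using strictly_increasing by (cases "s = t") (auto simp: less_imp_le)

lemma measurable_band [measurable]: "band \<in> sets (borel \<Otimes>\<^sub>M borel)"
proof -
  define \<psi> where "\<psi> s = (if 0 < s then \<phi> s else 0)" for s
  have [measurable]: "\<psi> \<in> borel_measurable borel"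
    unfolding \<psi>_def by (rule borel_measurable_mono_pos) (auto intro: increasing less_imp_le[OF pos])
  have "band = {z \<in> space (borel \<Otimes>\<^sub>M borel). 0 < fst z \<and> \<psi> (fst z / 2) \<le> snd z \<and> snd z \<le> \<psi> (fst z)}"
    by (auto simp: band_def \<psi>_def space_pair_measure)
  then show ?thesis by simp
qed

lemma not_band [simp]: "\<not> 0 < s \<Longrightarrow> (s, t) \<notin> band" "\<not> 0 < t \<Longrightarrow> (s, t) \<notin> band"
  using pos[of "s / 2"] by (auto simp: band_def)

text \<open>The supremum of the sublevel set \<open>\<phi> s \<le> t\<close> acts as the inverse of
  \<open>\<phi>\<close> at \<open>t\<close>. The lower growth bound makes \<open>\<phi>\<close> tend
  to infinity at infinity and to 0 at 0, so the supremum is finite and positive.\<close>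

lemma threshold_exists:
  assumes "0 < t"
  obtains \<sigma> where "0 < \<sigma>" "\<And>s. 0 < s \<Longrightarrow> s < \<sigma> \<Longrightarrow> \<phi> s \<le> t" "\<And>s. \<sigma> < s \<Longrightarrow> t < \<phi> s"
proof -
  define S where "S = {s. 0 < s \<and> \<phi> s \<le> t}"
  define b where "b = max 1 ((t / \<phi> 1)\<^sup>2)"
  have p1: "0 < \<phi> 1" by (rule pos) simp
  have bdd: "s \<le> b" if "s \<in> S" for s
  proof (cases "s \<le> 1")
    case False
    then have "\<phi> 1 * sqrt s \<le> t" using growth_lower[of 1 s] that by (auto simp: S_def)
    then have "sqrt s \<le> t / \<phi> 1" using p1 by (simp add: field_simps)
    then have "s \<le> (t / \<phi> 1)\<^sup>2" by (rule sqrt_le_D)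
    then show ?thesis by (simp add: b_def)
  qed (simp add: b_def)
  then have bdd': "bdd_above S" by (auto simp: bdd_above_def)
  \<comment> \<open>The witness that the sublevel set is nonempty: for \<open>c \<le> 1\<close>
    growth gives \<open>\<phi> c \<le> \<phi> 1 * sqrt c\<close>, which is at most \<open>t\<close>
    for this choice.\<close>
  define c where "c = min 1 ((t / \<phi> 1)\<^sup>2)"
  have c: "0 < c" "c \<le> 1" using p1 assms by (auto simp: c_def)
  have "\<phi> c * sqrt (1 / c) \<le> \<phi> 1" using growth_lower c by simp
  then have "\<phi> c \<le> \<phi> 1 * sqrt c" using c by (simp add: real_sqrt_divide field_simps)
  also have "\<dots> \<le> \<phi> 1 * (t / \<phi> 1)"
    using p1 assms by (intro mult_left_mono real_le_lsqrt) (auto simp: c_def)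
  finally have "c \<in> S" using c p1 by (simp add: S_def)
  show thesis
  proof
    show "0 < Sup S" using \<open>c \<in> S\<close> c bdd' cSup_upper[of c S] by linarith
    show "\<phi> s \<le> t" if s: "0 < s" "s < Sup S" for s
    proof -
      obtain s' where "s' \<in> S" "s < s'" using s(2) \<open>c \<in> S\<close> bdd' less_cSup_iff[of S s] by blast
      then show ?thesis using strictly_increasing[of s s'] s by (auto simp: S_def)
    qed
    show "t < \<phi> s" if "Sup S < s" for s
    proof (rule ccontr)
      assume "\<not> t < \<phi> s"
      then have "s \<in> S" using that \<open>0 < Sup S\<close> by (simp add: S_def)
      then show False using cSup_upper[OF _ bdd'] that by force
    qed
  qed
qed

text \<open>The section is the interval from \<open>\<phi> (s / 2)\<close> to
  \<open>\<phi> s\<close>. By the two growth bounds the ratio of its endpoints lies between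
  \<open>sqrt 2\<close> and 2.\<close>

lemma band_section_t:
  assumes "0 < s"
  shows "(\<integral>\<^sup>+t. ennreal (1 / t) * indicator band (s, t) \<partial>lborel) \<le> ennreal (ln 2)"
    and "ennreal (ln 2) \<le> 2 * (\<integral>\<^sup>+t. ennreal (1 / t) * indicator band (s, t) \<partial>lborel)"
proof -
  have p: "0 < \<phi> (s / 2)" using assms pos by simp
  have m: "\<phi> (s / 2) \<le> \<phi> s" using assms increasing by simp
  have "(\<lambda>t. indicator band (s, t) :: ennreal) = indicator {\<phi> (s / 2)..\<phi> s}"
    using assms by (auto simp: band_def indicator_def)
  then have *: "(\<integral>\<^sup>+t. ennreal (1 / t) * indicator band (s, t) \<partial>lborel) = ennreal (ln (\<phi> s / \<phi> (s / 2)))"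
    using nn_integral_inverse_Icc[OF p m] by (simp add: fun_eq_iff)
  have "\<phi> s / \<phi> (s / 2) \<le> 2" using growth_upper[of "s / 2" s] assms p by (simp add: field_simps)
  then show "(\<integral>\<^sup>+t. ennreal (1 / t) * indicator band (s, t) \<partial>lborel) \<le> ennreal (ln 2)"
    unfolding * using p m by (intro ennreal_leI) simp
  have "sqrt 2 \<le> \<phi> s / \<phi> (s / 2)" using growth_lower[of "s / 2" s] assms p by (simp add: field_simps)
  then have "ln (sqrt 2) \<le> ln (\<phi> s / \<phi> (s / 2))" using p m by simp
  then have "ln 2 \<le> 2 * ln (\<phi> s / \<phi> (s / 2))" by (simp add: ln_sqrt)
  then have "ennreal (ln 2) \<le> ennreal (2 * ln (\<phi> s / \<phi> (s / 2)))" by (rule ennreal_leI)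
  also have "\<dots> = 2 * ennreal (ln (\<phi> s / \<phi> (s / 2)))"
    using p m by (subst ennreal_mult) (auto simp: field_simps)
  finally show "ennreal (ln 2) \<le> 2 * (\<integral>\<^sup>+t. ennreal (1 / t) * indicator band (s, t) \<partial>lborel)"
    unfolding * .
qed

text \<open>Apart from endpoints the section runs from the threshold \<open>\<sigma>\<close> to its
  double, so its logarithmic length is exactly \<open>ln 2\<close>.\<close>

lemma band_section_s:
  assumes "0 < t"
  shows "(\<integral>\<^sup>+s. ennreal (1 / s) * indicator band (s, t) \<partial>lborel) = ennreal (ln 2)"
proof -
  obtain \<sigma> where \<sigma>: "0 < \<sigma>" "\<And>s. 0 < s \<Longrightarrow> s < \<sigma> \<Longrightarrow> \<phi> s \<le> t" "\<And>s. \<sigma> < s \<Longrightarrow> t < \<phi> s"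
    using threshold_exists[OF assms] by metis
  have in_band: "(s, t) \<in> band" if "\<sigma> < s" "s < 2 * \<sigma>" for s
    using that \<sigma>(1) \<sigma>(2)[of "s / 2"] \<sigma>(3)[of s] by (auto simp: band_def)
  have band_in: "\<sigma> \<le> s \<and> s \<le> 2 * \<sigma>" if sb: "(s, t) \<in> band" for s
  proof (rule ccontr)
    assume "\<not> (\<sigma> \<le> s \<and> s \<le> 2 * \<sigma>)"
    \<comment> \<open>At \<open>s\<close> itself \<open>\<phi> s = t\<close> is not yet excluded;
      the midpoint is still below \<open>\<sigma>\<close> but has a strictly larger value.\<close>
    moreover have False if "s < \<sigma>"
      using sb \<sigma>(2)[of "(s + \<sigma>) / 2"] strictly_increasing[of s "(s + \<sigma>) / 2"] that by (auto simp: band_def)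
    moreover have False if "2 * \<sigma> < s"
      using sb \<sigma>(3)[of "s / 2"] that by (auto simp: band_def)
    ultimately show False by linarith
  qed
  have "AE s in lborel. s \<noteq> \<sigma> \<and> s \<noteq> 2 * \<sigma>"
    using AE_lborel_singleton[of \<sigma>] AE_lborel_singleton[of "2 * \<sigma>"] by eventually_elim simp
  then have "AE s in lborel. indicator band (s, t) = (indicator {\<sigma>..2 * \<sigma>} s :: ennreal)"
    by eventually_elim (use in_band band_in in \<open>fastforce simp: indicator_def\<close>)
  then have "(\<integral>\<^sup>+s. ennreal (1 / s) * indicator band (s, t) \<partial>lborel)
      = (\<integral>\<^sup>+s. ennreal (1 / s) * indicator {\<sigma>..2 * \<sigma>} s \<partial>lborel)"
    by (intro nn_integral_cong_AE) auto
  also have "\<dots> = ennreal (ln 2)" using nn_integral_inverse_Icc[of \<sigma> "2 * \<sigma>"] \<sigma>(1) by simp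
  finally show ?thesis .
qed

text \<open>Write the left side, times \<open>ln 2\<close>, as an integral over the band, since
  every s-section has that length. On the band \<open>F t\<close> is replaced by
  \<open>c * G s\<close>; after exchanging the integrals, the t-sections contribute at most
  \<open>ln 2\<close>, which cancels.\<close>

lemma nn_integral_le_of_band:
  fixes F G :: "real \<Rightarrow> ennreal"
  assumes [measurable]: "F \<in> borel_measurable borel" "G \<in> borel_measurable borel"
    and FG: "\<And>s t. (s, t) \<in> band \<Longrightarrow> F t \<le> c * G s"
  shows "(\<integral>\<^sup>+t\<in>{0<..}. F t * ennreal (1 / t) \<partial>lborel) \<le> c * (\<integral>\<^sup>+s\<in>{0<..}. G s * ennreal (1 / s) \<partial>lborel)"
proof -
  let ?k = "\<lambda>s t. ennreal (1 / s) * ennreal (1 / t) * indicator band (s, t)"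
  have "ennreal (ln 2) * (\<integral>\<^sup>+t\<in>{0<..}. F t * ennreal (1 / t) \<partial>lborel)
      = (\<integral>\<^sup>+t. F t * ennreal (1 / t) * indicator {0<..} t * ennreal (ln 2) \<partial>lborel)"
    by (subst nn_integral_multc) (auto simp: mult.commute)
  also have "\<dots> = (\<integral>\<^sup>+t. F t * ennreal (1 / t) * indicator {0<..} t *
                    (\<integral>\<^sup>+s. ennreal (1 / s) * indicator band (s, t) \<partial>lborel) \<partial>lborel)"
    by (intro nn_integral_cong, rename_tac t, case_tac "0 < t") (simp_all add: band_section_s)
  also have "\<dots> = (\<integral>\<^sup>+t. \<integral>\<^sup>+s. F t * ennreal (1 / t) * indicator {0<..} t *
                    (ennreal (1 / s) * indicator band (s, t)) \<partial>lborel \<partial>lborel)"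
    by (intro nn_integral_cong nn_integral_cmult[symmetric]) simp
  also have "\<dots> \<le> (\<integral>\<^sup>+t. \<integral>\<^sup>+s. c * G s * ?k s t \<partial>lborel \<partial>lborel)"
  proof (intro nn_integral_mono)
    fix t s
    show "F t * ennreal (1 / t) * indicator {0<..} t * (ennreal (1 / s) * indicator band (s, t)) \<le> c * G s * ?k s t"
      using mult_right_mono[OF FG[of s t], of "ennreal (1 / t) * ennreal (1 / s)"]
      by (auto simp: indicator_def mult_ac)
  qed
  also have "\<dots> = (\<integral>\<^sup>+s. \<integral>\<^sup>+t. c * G s * ?k s t \<partial>lborel \<partial>lborel)"
    by (rule lborel_pair.Fubini') simp
  also have "\<dots> = (\<integral>\<^sup>+s. c * (G s * ennreal (1 / s) * indicator {0<..} s) *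
      (\<integral>\<^sup>+t. ennreal (1 / t) * indicator band (s, t) \<partial>lborel) \<partial>lborel)"
    by (intro nn_integral_cong, rename_tac s, case_tac "0 < s")
      (simp_all add: mult_ac flip: nn_integral_cmult)
  also have "\<dots> \<le> (\<integral>\<^sup>+s. c * (G s * ennreal (1 / s) * indicator {0<..} s) * ennreal (ln 2) \<partial>lborel)"
    by (intro nn_integral_mono, rename_tac s, case_tac "0 < s") (auto intro!: mult_left_mono band_section_t)
  also have "\<dots> = ennreal (ln 2) * (c * (\<integral>\<^sup>+s\<in>{0<..}. G s * ennreal (1 / s) \<partial>lborel))"
    by (subst nn_integral_multc) (auto simp: mult.commute nn_integral_cmult)
  finally show ?thesis by (subst (asm) ennreal_mult_le_mult_iff) auto
qed

text \<open>The same argument started from the t-sections, whose length is only known to be at least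
  half of \<open>ln 2\<close>; hence the factor 2.\<close>

lemma nn_integral_ge_of_band:
  fixes F G :: "real \<Rightarrow> ennreal"
  assumes [measurable]: "F \<in> borel_measurable borel" "G \<in> borel_measurable borel"
    and GF: "\<And>s t. (s, t) \<in> band \<Longrightarrow> G s \<le> c * F t"
  shows "(\<integral>\<^sup>+s\<in>{0<..}. G s * ennreal (1 / s) \<partial>lborel) \<le> 2 * c * (\<integral>\<^sup>+t\<in>{0<..}. F t * ennreal (1 / t) \<partial>lborel)"
proof -
  let ?k = "\<lambda>s t. ennreal (1 / s) * ennreal (1 / t) * indicator band (s, t)"
  have "ennreal (ln 2) * (\<integral>\<^sup>+s\<in>{0<..}. G s * ennreal (1 / s) \<partial>lborel)
      = (\<integral>\<^sup>+s. G s * ennreal (1 / s) * indicator {0<..} s * ennreal (ln 2) \<partial>lborel)"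
    by (subst nn_integral_multc) (auto simp: mult.commute)
  also have "\<dots> \<le> (\<integral>\<^sup>+s. G s * ennreal (1 / s) * indicator {0<..} s *
                    (2 * (\<integral>\<^sup>+t. ennreal (1 / t) * indicator band (s, t) \<partial>lborel)) \<partial>lborel)"
    by (intro nn_integral_mono, rename_tac s, case_tac "0 < s") (auto intro!: mult_left_mono band_section_t)
  also have "\<dots> = (\<integral>\<^sup>+s. \<integral>\<^sup>+t. 2 * (G s * ennreal (1 / s) * indicator {0<..} s) *
                    (ennreal (1 / t) * indicator band (s, t)) \<partial>lborel \<partial>lborel)"
    by (intro nn_integral_cong, subst nn_integral_cmult) (auto simp: mult_ac)
  also have "\<dots> \<le> (\<integral>\<^sup>+s. \<integral>\<^sup>+t. 2 * c * F t * ?k s t \<partial>lborel \<partial>lborel)"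
  proof (intro nn_integral_mono)
    fix t s
    show "2 * (G s * ennreal (1 / s) * indicator {0<..} s) * (ennreal (1 / t) * indicator band (s, t)) \<le> 2 * c * F t * ?k s t"
      using mult_right_mono[OF GF[of s t], of "2 * (ennreal (1 / t) * ennreal (1 / s))"]
      by (auto simp: indicator_def mult_ac)
  qed
  also have "\<dots> = (\<integral>\<^sup>+t. \<integral>\<^sup>+s. 2 * c * F t * ?k s t \<partial>lborel \<partial>lborel)"
    by (rule lborel_pair.Fubini'[symmetric]) simp
  also have "\<dots> = (\<integral>\<^sup>+t. 2 * c * (F t * ennreal (1 / t) * indicator {0<..} t) *
      (\<integral>\<^sup>+s. ennreal (1 / s) * indicator band (s, t) \<partial>lborel) \<partial>lborel)"
    by (intro nn_integral_cong, rename_tac t, case_tac "0 < t")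
      (simp_all add: mult_ac flip: nn_integral_cmult)
  also have "\<dots> = (\<integral>\<^sup>+t. 2 * c * (F t * ennreal (1 / t) * indicator {0<..} t) * ennreal (ln 2) \<partial>lborel)"
    by (intro nn_integral_cong, rename_tac t, case_tac "0 < t") (simp_all add: band_section_s)
  also have "\<dots> = ennreal (ln 2) * (2 * c * (\<integral>\<^sup>+t\<in>{0<..}. F t * ennreal (1 / t) \<partial>lborel))"
    by (subst nn_integral_multc) (auto simp: mult.commute nn_integral_cmult)
  finally show ?thesis by (subst (asm) ennreal_mult_le_mult_iff) auto
qed

end

section \<open>Nonnegative sums as integrals over the counting measure\<close>

lemma nn_integral_count_space_infsum:
  fixes g :: "'a \<Rightarrow> real"
  assumes "\<And>x. 0 \<le> g x" "g summable_on UNIV"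
  shows "(\<integral>\<^sup>+x. ennreal (g x) \<partial>count_space UNIV) = ennreal (\<Sum>\<^sub>\<infinity>x. g x)"
proof -
  have "Infinite_Set_Sum.abs_summable_on g UNIV"
    using assms(2) summable_on_iff_abs_summable_on_real abs_summable_equivalent by blast
  then show ?thesis
    using assms(1) by (simp add: nn_integral_conv_infsetsum infsetsum_infsum)
qed

lemma summable_on_iff_nn_integral_count_space:
  fixes g :: "'a \<Rightarrow> real"
  assumes "\<And>x. 0 \<le> g x"
  shows "g summable_on UNIV \<longleftrightarrow> (\<integral>\<^sup>+x. ennreal (g x) \<partial>count_space UNIV) < \<infinity>"
proof -
  have "g summable_on UNIV \<longleftrightarrow> Infinite_Set_Sum.abs_summable_on g UNIV"
    using summable_on_iff_abs_summable_on_real abs_summable_equivalent by blast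
  also have "\<dots> \<longleftrightarrow> (\<integral>\<^sup>+x. ennreal (g x) \<partial>count_space UNIV) < \<infinity>"
    unfolding Infinite_Set_Sum.abs_summable_on_def
    using assms by (simp add: integrable_iff_bounded)
  finally show ?thesis .
qed

section \<open>The K-functional\<close>

text \<open>Nonnegativity bounds the set under the infimum in \<open>K_functional\<close> from
  below, and membership in \<open>sum_space\<close> makes this set nonempty; together they make the
  real-valued \<open>Inf\<close> a true infimum.\<close>

locale normlike_couple =
  fixes X Y :: "'a::ab_group_add nspace"
  assumes nrm_nonneg: "x \<in> vecs X \<Longrightarrow> 0 \<le> nrm X x" "y \<in> vecs Y \<Longrightarrow> 0 \<le> nrm Y y"
begin

lemma K_functional_le:
  assumes "0 \<le> t" "x \<in> vecs X" "y \<in> vecs Y"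
  shows "K_functional X Y t (x + y) \<le> nrm X x + t * nrm Y y"
  unfolding K_functional_def
  using assms by (intro cInf_lower) (auto intro!: bdd_belowI[of _ 0] add_nonneg_nonneg mult_nonneg_nonneg nrm_nonneg)

lemma K_functional_ge:
  assumes "z \<in> sum_space X Y"
    and "\<And>x y. x \<in> vecs X \<Longrightarrow> y \<in> vecs Y \<Longrightarrow> z = x + y \<Longrightarrow> b \<le> nrm X x + t * nrm Y y"
  shows "b \<le> K_functional X Y t z"
  unfolding K_functional_def
  using assms by (intro cInf_greatest) (auto simp: sum_space_def)

lemma K_functional_nonneg:
  assumes "z \<in> sum_space X Y" "0 \<le> t"
  shows "0 \<le> K_functional X Y t z"
  using assms by (intro K_functional_ge) (auto intro!: add_nonneg_nonneg mult_nonneg_nonneg nrm_nonneg)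

lemma K_functional_mono:
  assumes "z \<in> sum_space X Y" "0 \<le> s" "s \<le> t"
  shows "K_functional X Y s z \<le> K_functional X Y t z"
proof (rule K_functional_ge[OF assms(1)])
  fix x y assume xy: "x \<in> vecs X" "y \<in> vecs Y" "z = x + y"
  then have "K_functional X Y s z \<le> nrm X x + s * nrm Y y" using K_functional_le assms by simp
  also have "\<dots> \<le> nrm X x + t * nrm Y y" using assms nrm_nonneg xy by (simp add: mult_right_mono)
  finally show "K_functional X Y s z \<le> nrm X x + t * nrm Y y" .
qed

end

section \<open>Weighted sequence spaces\<close>

text \<open>The integrand is \<open>r powr (1 - p)\<close> up to 1, integrable at 0 as
  \<open>p < 2\<close>, and \<open>r powr (-p)\<close> beyond 1, integrable at infinity as
  \<open>1 < p\<close>.\<close>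

lemma nn_integral_powr_min:
  fixes p :: real
  assumes "1 < p" "p < 2"
  obtains c where "0 < c" "(\<integral>\<^sup>+r\<in>{0<..}. ennreal (r powr (-p) * min 1 r) \<partial>lborel) = ennreal c"
proof -
  let ?I = "\<integral>\<^sup>+r\<in>{0<..}. ennreal (r powr (-p) * min 1 r) \<partial>lborel"
  have A: "(\<integral>\<^sup>+r. ennreal (r powr (-p)) * indicator {1..} r \<partial>lborel) = ennreal (1 / (p - 1))"
    using nn_integral_has_integral_lebesgue'[OF _ has_integral_powr_to_inf[of "-p" 1]] assms
    by (simp add: divide_simps)
  have B: "(\<integral>\<^sup>+r. ennreal (r powr (1 - p)) * indicator {0..1} r \<partial>lborel) = ennreal (1 / (2 - p))"
    using nn_integral_has_integral_lebesgue'[OF _ has_integral_powr_from_0[of "1 - p" 1]] assms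
    by simp
  have "?I \<le> (\<integral>\<^sup>+r. ennreal (r powr (-p)) * indicator {1..} r + ennreal (r powr (1 - p)) * indicator {0..1} r \<partial>lborel)"
    by (intro nn_integral_mono) (auto simp: indicator_def min_def powr_mult_base powr_diff powr_minus divide_simps)
  also have "\<dots> = ennreal (1 / (p - 1)) + ennreal (1 / (2 - p))"
    unfolding A[symmetric] B[symmetric] by (rule nn_integral_add) auto
  finally have "?I < \<infinity>" by (simp add: le_less_trans less_top)
  moreover have "ennreal (1 / (p - 1)) \<le> ?I"
    unfolding A[symmetric] by (intro nn_integral_mono) (auto simp: indicator_def)
  then have "0 < ?I" using assms by (auto intro: less_le_trans[rotated] simp: ennreal_zero_less_divide)
  ultimately show thesis
    using that[of "enn2real ?I"] by (simp add: enn2real_positive_iff)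
qed

lemma nn_integral_powr_min_scaled:
  fixes p \<alpha> \<beta> :: real
  assumes "0 < \<alpha>" "0 < \<beta>"
  shows "(\<integral>\<^sup>+s\<in>{0<..}. ennreal (s powr (-p) * min \<alpha> (s * \<beta>)) \<partial>lborel)
       = ennreal (\<alpha> powr (2 - p) * \<beta> powr (p - 1)) * (\<integral>\<^sup>+r\<in>{0<..}. ennreal (r powr (-p) * min 1 r) \<partial>lborel)"
proof -
  \<comment> \<open>The level at which the two branches of the minimum meet; the substitution
    \<open>s = d * r\<close> moves it to 1.\<close>
  define d where "d = \<alpha> / \<beta>"
  have d: "0 < d" using assms by (simp add: d_def)
  have "(\<integral>\<^sup>+s\<in>{0<..}. ennreal (s powr (-p) * min \<alpha> (s * \<beta>)) \<partial>lborel)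
     = ennreal \<bar>d\<bar> * (\<integral>\<^sup>+r. ennreal ((0 + d * r) powr (-p) * min \<alpha> ((0 + d * r) * \<beta>)) * indicator {0<..} (0 + d * r) \<partial>lborel)"
    by (rule nn_integral_real_affine) (use d in auto)
  also have "\<dots> = (\<integral>\<^sup>+r. ennreal \<bar>d\<bar> * (ennreal ((0 + d * r) powr (-p) * min \<alpha> ((0 + d * r) * \<beta>)) * indicator {0<..} (0 + d * r)) \<partial>lborel)"
    by (rule nn_integral_cmult[symmetric]) simp
  also have "\<dots> = (\<integral>\<^sup>+r. ennreal (\<alpha> powr (2 - p) * \<beta> powr (p - 1)) * (ennreal (r powr (-p) * min 1 r) * indicator {0<..} r) \<partial>lborel)"
  proof (intro nn_integral_cong)
    fix r :: real
    show "ennreal \<bar>d\<bar> * (ennreal ((0 + d * r) powr (-p) * min \<alpha> ((0 + d * r) * \<beta>)) * indicator {0<..} (0 + d * r))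
      = ennreal (\<alpha> powr (2 - p) * \<beta> powr (p - 1)) * (ennreal (r powr (-p) * min 1 r) * indicator {0<..} r)"
    proof (cases "0 < r")
      case True
      have "\<alpha> powr (2 - p) * \<beta> powr (p - 1) = d * d powr (-p) * \<alpha>"
        using assms by (simp add: d_def powr_divide powr_diff powr_minus field_simps power2_eq_square)
      moreover have "min \<alpha> (d * r * \<beta>) = \<alpha> * min 1 r"
        using assms by (simp add: d_def min_def)
      ultimately show ?thesis
        using True d assms by (simp add: powr_mult zero_less_mult_iff mult_ac flip: ennreal_mult)
    qed (use d in \<open>simp add: zero_less_mult_iff\<close>)
  qed
  also have "\<dots> = ennreal (\<alpha> powr (2 - p) * \<beta> powr (p - 1)) * (\<integral>\<^sup>+r\<in>{0<..}. ennreal (r powr (-p) * min 1 r) \<partial>lborel)"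
    by (rule nn_integral_cmult) simp
  finally show ?thesis .
qed

text \<open>The weights are norms of nonzero vectors. Countability of the index type allows sum and
  integral to be exchanged in \<open>nn_integral_k\<close>.\<close>

locale weighted =
  fixes X :: "'h nspace" and u :: "'i::countable \<Rightarrow> 'h"
  assumes weight_pos: "0 < nrm X (u \<xi>)"
begin

abbreviation w :: "'i \<Rightarrow> real" where "w \<xi> \<equiv> nrm X (u \<xi>)"

abbreviation L1 :: "('i \<Rightarrow> complex) nspace" where "L1 \<equiv> lp_space 1 X u"
abbreviation L2 :: "('i \<Rightarrow> complex) nspace" where "L2 \<equiv> lp_space 2 X u"

text \<open>The cheaper price of one coordinate: its term in the norm of \<open>L1\<close>, or
  \<open>s\<close> times its term in the squared norm of \<open>L2\<close>.\<close>

definition trunc :: "('i \<Rightarrow> complex) \<Rightarrow> real \<Rightarrow> 'i \<Rightarrow> real" where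
  "trunc a s \<xi> = min (cmod (a \<xi>) * w \<xi>) (s * (cmod (a \<xi>))\<^sup>2)"

definition k :: "('i \<Rightarrow> complex) \<Rightarrow> real \<Rightarrow> real" where
  "k a s = (\<Sum>\<^sub>\<infinity>\<xi>. trunc a s \<xi>)"

lemma w_nonneg: "0 \<le> w \<xi>" and w_neq_0 [simp]: "w \<xi> \<noteq> 0"
  using weight_pos[of \<xi>] by simp_all

lemma vecs_L1: "a \<in> vecs L1 \<longleftrightarrow> (\<lambda>\<xi>. cmod (a \<xi>) * w \<xi>) summable_on UNIV"
  by (simp add: lp_space_def w_nonneg)

lemma nrm_L1: "nrm L1 a = (\<Sum>\<^sub>\<infinity>\<xi>. cmod (a \<xi>) * w \<xi>)"
  by (simp add: lp_space_def w_nonneg infsum_nonneg)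

lemma vecs_L2: "a \<in> vecs L2 \<longleftrightarrow> (\<lambda>\<xi>. (cmod (a \<xi>))\<^sup>2) summable_on UNIV"
  by (simp add: lp_space_def)

lemma nrm_L2: "nrm L2 a = sqrt (\<Sum>\<^sub>\<infinity>\<xi>. (cmod (a \<xi>))\<^sup>2)"
  by (simp add: lp_space_def powr_half_sqrt infsum_nonneg)

sublocale normlike_couple L1 L2
  by standard (auto simp: nrm_L1 nrm_L2 infsum_nonneg w_nonneg)

section \<open>Splittings and their cost\<close>

lemma trunc_nonneg: "0 \<le> s \<Longrightarrow> 0 \<le> trunc a s \<xi>"
  by (simp add: trunc_def w_nonneg)

text \<open>The sum is at most twice the larger summand. If that is \<open>x \<xi>\<close>, the
  linear branch of the minimum costs a factor 2; otherwise the quadratic branch costs 4.\<close>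

lemma trunc_add_le:
  assumes "0 \<le> s"
  shows "trunc (x + y) s \<xi> \<le> 2 * (cmod (x \<xi>) * w \<xi>) + 4 * s * (cmod (y \<xi>))\<^sup>2"
proof (cases "cmod (y \<xi>) \<le> cmod (x \<xi>)")
  case True
  have "cmod (x \<xi> + y \<xi>) \<le> 2 * cmod (x \<xi>)" using norm_triangle_ineq[of "x \<xi>" "y \<xi>"] True by simp
  then have "cmod (x \<xi> + y \<xi>) * w \<xi> \<le> 2 * cmod (x \<xi>) * w \<xi>" by (rule mult_right_mono) (rule w_nonneg)
  then show ?thesis using assms by (simp add: trunc_def min_le_iff_disj add_increasing2)
next
  case False
  have "cmod (x \<xi> + y \<xi>) \<le> 2 * cmod (y \<xi>)" using norm_triangle_ineq[of "x \<xi>" "y \<xi>"] False by simp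
  then have "(cmod (x \<xi> + y \<xi>))\<^sup>2 \<le> (2 * cmod (y \<xi>))\<^sup>2" by (rule power_mono) simp
  then have "s * (cmod (x \<xi> + y \<xi>))\<^sup>2 \<le> s * (2 * cmod (y \<xi>))\<^sup>2" using assms by (rule mult_left_mono)
  then show ?thesis by (simp add: trunc_def min_le_iff_disj add_increasing w_nonneg power_mult_distrib mult_ac)
qed

lemma k_add_le:
  assumes "0 < s" "x \<in> vecs L1" "y \<in> vecs L2"
  shows "trunc (x + y) s summable_on UNIV"
    and "k (x + y) s \<le> 2 * nrm L1 x + 4 * s * (nrm L2 y)\<^sup>2"
proof -
  have sx: "(\<lambda>\<xi>. 2 * (cmod (x \<xi>) * w \<xi>)) summable_on UNIV"
    using assms by (intro summable_on_cmult_right) (simp add: vecs_L1)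
  have sy: "(\<lambda>\<xi>. 4 * s * (cmod (y \<xi>))\<^sup>2) summable_on UNIV"
    using assms by (intro summable_on_cmult_right) (simp add: vecs_L2)
  show s: "trunc (x + y) s summable_on UNIV"
    by (rule summable_on_comparison_test[OF summable_on_add[OF sx sy]])
       (use assms in \<open>auto intro: trunc_nonneg trunc_add_le\<close>)
  have "k (x + y) s \<le> (\<Sum>\<^sub>\<infinity>\<xi>. 2 * (cmod (x \<xi>) * w \<xi>) + 4 * s * (cmod (y \<xi>))\<^sup>2)"
    unfolding k_def by (rule infsum_mono[OF s summable_on_add[OF sx sy]]) (use assms in \<open>simp add: trunc_add_le\<close>)
  also have "\<dots> = 2 * nrm L1 x + 4 * s * (nrm L2 y)\<^sup>2"
    by (subst infsum_add[OF sx sy]) (simp add: infsum_cmult_right' nrm_L1 nrm_L2 infsum_nonneg)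
  finally show "k (x + y) s \<le> 2 * nrm L1 x + 4 * s * (nrm L2 y)\<^sup>2" .
qed

lemma split_at_level:
  assumes s: "0 < s" and sm: "trunc a s summable_on UNIV"
  obtains x y where "x \<in> vecs L1" "y \<in> vecs L2" "a = x + y"
    "nrm L1 x \<le> k a s" "s * (nrm L2 y)\<^sup>2 \<le> k a s"
proof -
  \<comment> \<open>These are the nonzero coordinates where the linear branch is strictly smaller,
    so each coordinate goes to the space in which it is cheaper.\<close>
  define B where "B = {\<xi>. w \<xi> < s * cmod (a \<xi>)}"
  define x where "x \<xi> = (if \<xi> \<in> B then a \<xi> else 0)" for \<xi>
  define y where "y \<xi> = (if \<xi> \<in> B then 0 else a \<xi>)" for \<xi>
  have x_le: "cmod (x \<xi>) * w \<xi> \<le> trunc a s \<xi>" for \<xi>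
    using s mult_left_mono[of "w \<xi>" "s * cmod (a \<xi>)" "cmod (a \<xi>)"] trunc_nonneg[of s a \<xi>]
    by (auto simp: x_def B_def trunc_def power2_eq_square mult_ac)
  have y_le: "s * (cmod (y \<xi>))\<^sup>2 \<le> trunc a s \<xi>" for \<xi>
    using s mult_left_mono[of "s * cmod (a \<xi>)" "w \<xi>" "cmod (a \<xi>)"] trunc_nonneg[of s a \<xi>]
    by (auto simp: y_def B_def trunc_def power2_eq_square mult_ac)
  have sx: "(\<lambda>\<xi>. cmod (x \<xi>) * w \<xi>) summable_on UNIV"
    by (rule summable_on_comparison_test[OF sm]) (auto simp: x_le w_nonneg)
  have sy: "(\<lambda>\<xi>. s * (cmod (y \<xi>))\<^sup>2) summable_on UNIV"
    by (rule summable_on_comparison_test[OF sm]) (use s in \<open>auto simp: y_le\<close>)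
  show thesis
  proof
    show "x \<in> vecs L1" using sx by (simp add: vecs_L1)
    show "y \<in> vecs L2" using sy s by (simp add: vecs_L2 summable_on_cmult_right')
    show "a = x + y" by (auto simp: fun_eq_iff x_def y_def)
    show "nrm L1 x \<le> k a s" unfolding nrm_L1 k_def by (rule infsum_mono[OF sx sm]) (rule x_le)
    have "(\<Sum>\<^sub>\<infinity>\<xi>. s * (cmod (y \<xi>))\<^sup>2) \<le> k a s" unfolding k_def by (rule infsum_mono[OF sy sm]) (rule y_le)
    then show "s * (nrm L2 y)\<^sup>2 \<le> k a s" by (simp add: nrm_L2 infsum_cmult_right' infsum_nonneg)
  qed
qed

text \<open>Since the left side does not mention \<open>s\<close>, summability at one positive level
  gives it at all of them.\<close>

lemma sum_space_iff:
  assumes "0 < s"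
  shows "a \<in> sum_space L1 L2 \<longleftrightarrow> trunc a s summable_on UNIV"
proof
  assume "trunc a s summable_on UNIV"
  from split_at_level[OF assms this] show "a \<in> sum_space L1 L2" unfolding sum_space_def by blast
qed (auto simp: sum_space_def intro: k_add_le(1)[OF assms])

section \<open>Growth of \<open>k\<close> and comparison with the K-functional\<close>

lemma trunc_mono: "s \<le> t \<Longrightarrow> trunc a s \<xi> \<le> trunc a t \<xi>"
  unfolding trunc_def by (intro min.mono mult_right_mono) (auto simp: w_nonneg)

text \<open>Of the two branches one is constant in the level and the other is linear, so both grow
  by at most the factor \<open>t / s\<close>.\<close>

lemma trunc_scale:
  assumes "0 < s" "s \<le> t"
  shows "trunc a t \<xi> \<le> t / s * trunc a s \<xi>"
proof -
  have "cmod (a \<xi>) * w \<xi> \<le> t / s * (cmod (a \<xi>) * w \<xi>)"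
    using assms mult_right_mono[of 1 "t / s" "cmod (a \<xi>) * w \<xi>"] by (simp add: w_nonneg)
  then have "trunc a t \<xi> \<le> min (t / s * (cmod (a \<xi>) * w \<xi>)) (t / s * (s * (cmod (a \<xi>))\<^sup>2))"
    unfolding trunc_def using assms by (intro min.mono) auto
  also have "\<dots> = t / s * trunc a s \<xi>" unfolding trunc_def using assms by (simp add: min_mult_distrib_left)
  finally show ?thesis .
qed

context
  fixes a
  assumes a: "a \<in> sum_space L1 L2"
begin

lemma summable_trunc: "0 < s \<Longrightarrow> trunc a s summable_on UNIV"
  using sum_space_iff a by simp

lemma k_nonneg: "0 < s \<Longrightarrow> 0 \<le> k a s"
  unfolding k_def by (rule infsum_nonneg) (simp add: trunc_nonneg)

lemma k_mono: "0 < s \<Longrightarrow> s \<le> t \<Longrightarrow> k a s \<le> k a t"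
  unfolding k_def by (intro infsum_mono summable_trunc trunc_mono) auto

lemma k_scale:
  assumes "0 < s" "s \<le> t"
  shows "k a t \<le> t / s * k a s"
proof -
  have "k a t \<le> (\<Sum>\<^sub>\<infinity>\<xi>. t / s * trunc a s \<xi>)"
    unfolding k_def using assms
    by (intro infsum_mono summable_on_cmult_right summable_trunc trunc_scale) auto
  then show ?thesis by (simp only: k_def infsum_cmult_right')
qed

lemma k_pos:
  assumes "a \<noteq> 0" "0 < s"
  shows "0 < k a s"
proof -
  obtain \<xi> where "a \<xi> \<noteq> 0" using assms by (auto simp: fun_eq_iff)
  then have "0 < trunc a s \<xi>" using assms weight_pos by (simp add: trunc_def)
  also have "trunc a s \<xi> = infsum (trunc a s) {\<xi>}" by simp
  also have "\<dots> \<le> k a s" unfolding k_def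
    by (rule infsum_mono_neutral) (use assms in \<open>auto intro: summable_trunc trunc_nonneg\<close>)
  finally show ?thesis .
qed

text \<open>The lower bound holds because \<open>k a s\<close> is nondecreasing in \<open>s\<close>,
  the upper one because \<open>k a s / s\<close> is nonincreasing.\<close>

lemma half_power_growth_k:
  assumes "a \<noteq> 0"
  shows "half_power_growth (\<lambda>s. sqrt (s * k a s))"
proof
  fix s t :: real
  assume s: "0 < s"
  then show "0 < sqrt (s * k a s)" using k_pos assms by simp
  assume st: "s \<le> t"
  have "sqrt (s * k a s) * sqrt (t / s) = sqrt (t * k a s)" using s by (simp flip: real_sqrt_mult)
  also have "\<dots> \<le> sqrt (t * k a t)" using k_mono s st by simp
  finally show "sqrt (s * k a s) * sqrt (t / s) \<le> sqrt (t * k a t)" .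
  have "sqrt (t * k a t) \<le> sqrt (t * (t / s * k a s))" using s st by (intro real_sqrt_le_mono mult_left_mono k_scale) auto
  also have "t * (t / s * k a s) = s * k a s * (t / s)\<^sup>2" using s by (simp add: power2_eq_square)
  also have "sqrt \<dots> = sqrt (s * k a s) * (t / s)" using s st by (simp add: real_sqrt_mult)
  finally show "sqrt (t * k a t) \<le> sqrt (s * k a s) * (t / s)" .
qed

text \<open>Splitting at level \<open>s\<close> makes both parts cheap: the \<open>L1\<close> part
  costs at most \<open>k a s\<close>, and \<open>t * nrm L2 y\<close> has square at most
  \<open>s * k a s * (nrm L2 y)\<^sup>2\<close>, hence at most
  \<open>(k a s)\<^sup>2\<close>.\<close>

lemma K_functional_le_k:
  assumes "0 < s" "0 \<le> t" "t\<^sup>2 \<le> s * k a s"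
  shows "K_functional L1 L2 t a \<le> 2 * k a s"
proof -
  obtain x y where xy: "x \<in> vecs L1" "y \<in> vecs L2" "a = x + y" "nrm L1 x \<le> k a s" "s * (nrm L2 y)\<^sup>2 \<le> k a s"
    using split_at_level summable_trunc assms(1) by blast
  have "(t * nrm L2 y)\<^sup>2 \<le> s * k a s * (nrm L2 y)\<^sup>2"
    using assms by (simp add: power_mult_distrib mult_right_mono)
  also have "\<dots> \<le> k a s * k a s"
    using mult_left_mono[OF xy(5) k_nonneg[OF assms(1)]] by (simp add: mult_ac)
  finally have "t * nrm L2 y \<le> k a s"
    using k_nonneg[OF assms(1)] by (metis power2_eq_square power2_le_imp_le)
  then show ?thesis using K_functional_le[OF assms(2) xy(1,2)] xy by simp
qed

text \<open>Bounding \<open>k a s\<close> by the cost of a splitting leaves the square of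
  \<open>nrm L2 y\<close>; multiplying by \<open>k a s\<close> and using the hypothesis turns the
  factor \<open>s * k a s\<close> into \<open>4 * t\<^sup>2\<close>, so only the cost
  \<open>n\<close> remains.\<close>

lemma k_le_K_functional:
  assumes "0 < s" "0 < t" "s * k a s \<le> 4 * t\<^sup>2"
  shows "k a s \<le> 6 * K_functional L1 L2 t a"
proof -
  have "k a s / 6 \<le> K_functional L1 L2 t a"
  proof (rule K_functional_ge[OF a], rule ccontr)
    fix x y
    assume xy: "x \<in> vecs L1" "y \<in> vecs L2" "a = x + y"
    define n where "n = nrm L1 x + t * nrm L2 y"
    assume "\<not> k a s / 6 \<le> nrm L1 x + t * nrm L2 y"
    then have n: "6 * n < k a s" by (simp add: n_def)
    have n0: "0 \<le> n" "nrm L1 x \<le> n" "t * nrm L2 y \<le> n" using xy assms nrm_nonneg by (auto simp: n_def)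
    have "(t * nrm L2 y)\<^sup>2 \<le> n\<^sup>2" using n0 nrm_nonneg xy assms by (intro power_mono) auto
    then have *: "t\<^sup>2 * (nrm L2 y)\<^sup>2 \<le> n\<^sup>2" by (simp add: power_mult_distrib)
    have "k a s * (k a s - 2 * n) \<le> k a s * (4 * s * (nrm L2 y)\<^sup>2)"
      using k_add_le(2)[OF assms(1) xy(1,2)] xy n0 k_nonneg[OF assms(1)] by (intro mult_left_mono) auto
    also have "\<dots> = 4 * (s * k a s) * (nrm L2 y)\<^sup>2" by simp
    also have "\<dots> \<le> 4 * (4 * t\<^sup>2) * (nrm L2 y)\<^sup>2" using assms by (intro mult_right_mono) auto
    also have "\<dots> \<le> 16 * n\<^sup>2" using * by simp
    finally have 1: "k a s * (k a s - 2 * n) \<le> 16 * n\<^sup>2" .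
    \<comment> \<open>The constant 6 is large enough because \<open>6 * (6 - 2) = 24\<close> exceeds
      16. This leaves \<open>n = 0\<close>, where the previous bound contradicts
      \<open>0 < k a s\<close>.\<close>
    have "(6 * n) * (4 * n) \<le> k a s * (k a s - 2 * n)" using n n0 by (intro mult_mono) auto
    with 1 have "n\<^sup>2 \<le> 0" by (simp add: power2_eq_square)
    then have "n = 0" by simp
    with 1 n show False by (simp add: mult_le_0_iff)
  qed
  then show ?thesis by simp
qed

end

end

section \<open>From \<open>p\<close>-th powers to norms; arithmetic of the exponents\<close>

lemma same_spaceI:
  fixes A B :: "'a nspace" and S :: "'a \<Rightarrow> ennreal"
  assumes "0 < q" "0 < c" "0 < d"
    and "vecs A = {a \<in> M. I a < \<infinity>}" "\<And>a. nrm A a = enn2real (I a) powr (1 / q)"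
    and "vecs B = {a \<in> M. S a < \<infinity>}" "\<And>a. a \<in> vecs B \<Longrightarrow> nrm B a = enn2real (S a) powr (1 / q)"
    and IS: "\<And>a. a \<in> M \<Longrightarrow> I a \<le> ennreal c * S a"
    and SI: "\<And>a. a \<in> M \<Longrightarrow> S a \<le> ennreal d * I a"
  shows "A \<approx> B"
proof -
  \<comment> \<open>Both constants are finite, so the two estimates carry finiteness in either
    direction; on the common set the norms compare after taking \<open>q\<close>-th roots.\<close>
  have fin: "I a < \<infinity> \<longleftrightarrow> S a < \<infinity>" if "a \<in> M" for a
    using IS[OF that] SI[OF that]
    by (auto simp: ennreal_mult_less_top top_unique less_top intro: le_less_trans)
  have vecs: "vecs A = vecs B" using assms(4,6) fin by auto
  have ineq: "c powr (- (1 / q)) * nrm A a \<le> nrm B a \<and> nrm B a \<le> d powr (1 / q) * nrm A a"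
    if "a \<in> vecs A" for a
  proof -
    have a: "a \<in> M" "I a < \<infinity>" "S a < \<infinity>" "a \<in> vecs B" using that vecs assms(4,6) by auto
    define i s where "i = enn2real (I a)" and "s = enn2real (S a)"
    have is0: "0 \<le> i" "0 \<le> s" "I a = ennreal i" "S a = ennreal s" using a by (auto simp: i_def s_def)
    have "i \<le> c * s" "s \<le> d * i"
      using IS[OF a(1)] SI[OF a(1)] is0 assms(2,3) by (simp_all flip: ennreal_mult)
    then have "i powr (1 / q) \<le> (c * s) powr (1 / q)" "s powr (1 / q) \<le> (d * i) powr (1 / q)"
      using is0 assms(1) by (auto intro!: powr_mono2)
    then have "i powr (1 / q) \<le> c powr (1 / q) * s powr (1 / q)" "s powr (1 / q) \<le> d powr (1 / q) * i powr (1 / q)"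
      using is0 assms by (auto simp: powr_mult)
    then show ?thesis
      using assms a by (simp add: i_def[symmetric] s_def[symmetric] powr_minus field_simps)
  qed
  show ?thesis
    unfolding same_space_def
    by (intro conjI vecs exI[of _ "c powr (- (1 / q))"] exI[of _ "d powr (1 / q)"] ballI ineq) (use assms in auto)
qed

lemma powr_interp_bounds:
  fixes \<theta> p s t k K :: real
  assumes \<theta>: "0 < \<theta>" "\<theta> < 1" and p: "p = 2 / (2 - \<theta>)"
    and pos: "0 < s" "0 < t" "0 < k" "0 \<le> K"
    and t: "s * k \<le> 4 * t\<^sup>2" "t\<^sup>2 \<le> s * k" and K: "K \<le> 2 * k" "k \<le> 6 * K"
  shows "(t powr (-\<theta>) * K) powr p \<le> (4 powr (p - 1) * 2 powr p) * (s powr (1 - p) * k)"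
    and "s powr (1 - p) * k \<le> 6 powr p * (t powr (-\<theta>) * K) powr p"
proof -
  have p1: "1 < p" using \<theta> by (simp add: p)
  \<comment> \<open>Here the relation between \<open>p\<close> and \<open>\<theta>\<close> enters:
    it makes the power of \<open>t\<close> a power of \<open>t\<^sup>2\<close>, which is comparable
    to \<open>s * k\<close>. The remaining product \<open>(s * k) powr (1 - p) * k powr p\<close> is
    \<open>s powr (1 - p) * k\<close>.\<close>
  have "- \<theta> * p = 2 * (1 - p)" using \<theta> by (simp add: p field_simps)
  then have "(t powr (-\<theta>)) powr p = (t powr 2) powr (1 - p)" by (simp add: powr_powr)
  then have tp: "(t powr (-\<theta>) * K) powr p = (t\<^sup>2) powr (1 - p) * K powr p"
    using pos by (simp add: powr_mult)
  have sk: "s powr (1 - p) * k = (s * k) powr (1 - p) * k powr p"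
    using pos by (simp add: powr_mult powr_diff field_simps)
  \<comment> \<open>The exponent is negative, so the lower bound on \<open>t\<^sup>2\<close> gives
    an upper bound.\<close>
  have "(t\<^sup>2) powr (1 - p) \<le> (s * k / 4) powr (1 - p)"
    using pos t p1 by (intro powr_mono2') auto
  also have "\<dots> = 4 powr (p - 1) * (s * k) powr (1 - p)"
    using pos by (simp add: powr_divide powr_diff field_simps)
  finally have "(t\<^sup>2) powr (1 - p) * K powr p \<le> (4 powr (p - 1) * (s * k) powr (1 - p)) * (2 * k) powr p"
    using pos K p1 by (intro mult_mono powr_mono2) auto
  then show "(t powr (-\<theta>) * K) powr p \<le> (4 powr (p - 1) * 2 powr p) * (s powr (1 - p) * k)"
    unfolding tp sk using pos by (simp add: powr_mult mult_ac)
  have "(s * k) powr (1 - p) * k powr p \<le> (t\<^sup>2) powr (1 - p) * (6 * K) powr p"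
    using pos t K p1 by (intro mult_mono powr_mono2 powr_mono2') auto
  then show "s powr (1 - p) * k \<le> 6 powr p * (t powr (-\<theta>) * K) powr p"
    unfolding tp sk using pos by (simp add: powr_mult mult_ac)
qed

text \<open>With \<open>x\<close> the modulus of a coordinate and \<open>y\<close> its weight, this
  recognises the constant of \<open>nn_integral_powr_min_scaled\<close> as a term of the sum
  defining \<open>lp_space p\<close>.\<close>

lemma powr_weight_identity:
  fixes x y p :: real
  assumes "0 < x" "0 < y"
  shows "(x * y) powr (2 - p) * (x\<^sup>2) powr (p - 1) = x powr p * y powr (2 - p)"
proof -
  have "(x\<^sup>2) powr (p - 1) = x powr (2 * (p - 1))"
    using assms by (simp add: powr_powr flip: powr_numeral)
  moreover have "x powr p = x powr (2 - p) * x powr (2 * (p - 1))"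
    by (simp flip: powr_add)
  ultimately show ?thesis
    using assms by (simp add: powr_mult)
qed

section \<open>Identification of the interpolation space\<close>

context weighted
begin

text \<open>The \<open>p\<close>-th power of the norm, with values in \<open>ennreal\<close> so that
  divergence is recorded as infinity and membership becomes finiteness.\<close>

definition modular :: "real \<Rightarrow> ('i \<Rightarrow> complex) \<Rightarrow> ennreal" where
  "modular p a = (\<integral>\<^sup>+\<xi>. ennreal (cmod (a \<xi>) powr p * w \<xi> powr (2 - p)) \<partial>count_space UNIV)"

lemma vecs_lp_iff_modular: "a \<in> vecs (lp_space p X u) \<longleftrightarrow> modular p a < \<infinity>"
  unfolding modular_def by (subst summable_on_iff_nn_integral_count_space[symmetric]) (auto simp: lp_space_def)

lemma nrm_lp_eq_modular:
  assumes "a \<in> vecs (lp_space p X u)"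
  shows "nrm (lp_space p X u) a = enn2real (modular p a) powr (1 / p)"
  using assms unfolding modular_def
  by (subst nn_integral_count_space_infsum) (auto simp: lp_space_def infsum_nonneg)

text \<open>A minimum is at most any weighted geometric mean; the weights \<open>2 - p\<close> and
  \<open>p - 1\<close> turn the two branches of \<open>trunc a 1\<close> into a term of the sum for
  \<open>lp_space p\<close>.\<close>

lemma lp_subset_sum_space:
  assumes p: "1 < p" "p < 2" and a: "a \<in> vecs (lp_space p X u)"
  shows "a \<in> sum_space L1 L2"
proof -
  have "trunc a 1 summable_on UNIV"
  proof (rule summable_on_comparison_test)
    show "(\<lambda>\<xi>. cmod (a \<xi>) powr p * w \<xi> powr (2 - p)) summable_on UNIV" using a by (simp add: lp_space_def)
    show "trunc a 1 \<xi> \<le> cmod (a \<xi>) powr p * w \<xi> powr (2 - p)" for \<xi>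
    proof (cases "a \<xi> = 0")
      case False
      let ?x = "cmod (a \<xi>) * w \<xi>" and ?y = "(cmod (a \<xi>))\<^sup>2"
      have xy: "0 < ?x" "0 < ?y" using False weight_pos by auto
      have "min ?x ?y = min ?x ?y powr (2 - p) * min ?x ?y powr (p - 1)"
        using xy by (simp flip: powr_add)
      also have "\<dots> \<le> ?x powr (2 - p) * ?y powr (p - 1)"
        using xy p by (intro mult_mono powr_mono2) auto
      also have "\<dots> = cmod (a \<xi>) powr p * w \<xi> powr (2 - p)"
        using False weight_pos by (simp add: powr_weight_identity)
      finally show ?thesis by (simp add: trunc_def)
    qed (simp add: trunc_def)
    show "0 \<le> trunc a 1 \<xi>" for \<xi> by (simp add: trunc_nonneg)
  qed
  then show ?thesis by (simp add: sum_space_iff[of 1])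
qed

lemma nn_integral_k:
  assumes a: "a \<in> sum_space L1 L2"
  shows "(\<integral>\<^sup>+s\<in>{0<..}. ennreal (s powr (-p) * k a s) \<partial>lborel)
       = (\<integral>\<^sup>+r\<in>{0<..}. ennreal (r powr (-p) * min 1 r) \<partial>lborel) * modular p a"
proof -
  let ?c = "\<integral>\<^sup>+r\<in>{0<..}. ennreal (r powr (-p) * min 1 r) \<partial>lborel"
  have "(\<integral>\<^sup>+s\<in>{0<..}. ennreal (s powr (-p) * k a s) \<partial>lborel)
    = (\<integral>\<^sup>+s. \<integral>\<^sup>+\<xi>. ennreal (s powr (-p) * trunc a s \<xi>) * indicator {0<..} s \<partial>count_space UNIV \<partial>lborel)"
  proof (intro nn_integral_cong)
    fix s :: real
    show "ennreal (s powr (-p) * k a s) * indicator {0<..} s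
        = (\<integral>\<^sup>+\<xi>. ennreal (s powr (-p) * trunc a s \<xi>) * indicator {0<..} s \<partial>count_space UNIV)"
    proof (cases "0 < s")
      case True
      have "(\<integral>\<^sup>+\<xi>. ennreal (s powr (-p) * trunc a s \<xi>) \<partial>count_space UNIV)
          = ennreal (\<Sum>\<^sub>\<infinity>\<xi>. s powr (-p) * trunc a s \<xi>)"
        using True a by (intro nn_integral_count_space_infsum summable_on_cmult_right summable_trunc)
          (auto simp: trunc_nonneg)
      then show ?thesis using True by (simp add: k_def infsum_cmult_right')
    qed simp
  qed
  also have "\<dots> = (\<integral>\<^sup>+\<xi>. \<integral>\<^sup>+s. ennreal (s powr (-p) * trunc a s \<xi>) * indicator {0<..} s \<partial>lborel \<partial>count_space UNIV)"
    by (rule nn_integral_count_space_nn_integral) (auto simp: trunc_def)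
  also have "\<dots> = (\<integral>\<^sup>+\<xi>. ?c * ennreal (cmod (a \<xi>) powr p * w \<xi> powr (2 - p)) \<partial>count_space UNIV)"
  proof (intro nn_integral_cong)
    fix \<xi>
    show "(\<integral>\<^sup>+s. ennreal (s powr (-p) * trunc a s \<xi>) * indicator {0<..} s \<partial>lborel)
      = ?c * ennreal (cmod (a \<xi>) powr p * w \<xi> powr (2 - p))"
    proof (cases "a \<xi> = 0")
      case False
      have "(cmod (a \<xi>) * w \<xi>) powr (2 - p) * (cmod (a \<xi>))\<^sup>2 powr (p - 1) = cmod (a \<xi>) powr p * w \<xi> powr (2 - p)"
        using False weight_pos by (simp add: powr_weight_identity)
      then show ?thesis
        using nn_integral_powr_min_scaled[of "cmod (a \<xi>) * w \<xi>" "(cmod (a \<xi>))\<^sup>2" p] False weight_pos[of \<xi>]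
        by (simp add: trunc_def mult.commute[of ?c])
    qed (simp add: trunc_def)
  qed
  also have "\<dots> = ?c * modular p a"
    unfolding modular_def by (rule nn_integral_cmult) simp
  finally show ?thesis .
qed

lemma interp_integral_bounds:
  assumes \<theta>: "0 < \<theta>" "\<theta> < 1" and p: "p = 2 / (2 - \<theta>)" and a: "a \<in> sum_space L1 L2"
  shows "interp_integral \<theta> p L1 L2 a
       \<le> ennreal (4 powr (p - 1) * 2 powr p) * (\<integral>\<^sup>+s\<in>{0<..}. ennreal (s powr (-p) * k a s) \<partial>lborel)" (is ?le)
    and "(\<integral>\<^sup>+s\<in>{0<..}. ennreal (s powr (-p) * k a s) \<partial>lborel)
       \<le> ennreal (2 * 6 powr p) * interp_integral \<theta> p L1 L2 a" (is ?ge)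
proof -
  let ?K = "\<lambda>t. K_functional L1 L2 t a"
  have "?le \<and> ?ge"
  \<comment> \<open>The zero sequence is separate because the curve \<open>sqrt (s * k a s)\<close>
    is positive only for \<open>a \<noteq> 0\<close>.\<close>
  proof (cases "a = 0")
    case True
    have k0: "k a s = 0" for s by (simp add: True k_def trunc_def)
    have "?K t = 0" if "0 < t" for t
      using K_functional_le_k[OF a, of "1" 0] K_functional_nonneg[OF a, of t] that
        K_functional_le[of t 0 0] by (simp add: True vecs_L1 vecs_L2 nrm_L1 nrm_L2)
    then have "interp_integral \<theta> p L1 L2 a = (\<integral>\<^sup>+(t::real). 0 \<partial>lborel)"
      unfolding interp_integral_def by (intro nn_integral_cong) (auto simp: indicator_def)
    then show ?thesis by (simp add: k0)
  next
    case False
    interpret half_power_growth "\<lambda>s. sqrt (s * k a s)" by (rule half_power_growth_k[OF a False])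
    define F where "F t = ennreal ((t powr (-\<theta>) * (if 0 < t then ?K t else 0)) powr p)" for t
    \<comment> \<open>The exponent is \<open>1 - p\<close> because one factor \<open>1 / s\<close>
      is split off for the measure \<open>ds / s\<close>.\<close>
    define G where "G s = ennreal (s powr (1 - p) * (if 0 < s then k a s else 0))" for s
    have [measurable]: "(\<lambda>t. if 0 < t then ?K t else 0) \<in> borel_measurable borel"
      by (rule borel_measurable_mono_pos) (auto intro: K_functional_nonneg K_functional_mono a)
    have [measurable]: "(\<lambda>s. if 0 < s then k a s else 0) \<in> borel_measurable borel"
      by (rule borel_measurable_mono_pos) (auto intro: k_nonneg k_mono a)
    have [measurable]: "F \<in> borel_measurable borel" "G \<in> borel_measurable borel"
      unfolding F_def G_def by measurable
    have IF: "interp_integral \<theta> p L1 L2 a = (\<integral>\<^sup>+t\<in>{0<..}. F t * ennreal (1 / t) \<partial>lborel)"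
      unfolding interp_integral_def F_def
      by (intro nn_integral_cong) (auto simp: indicator_def simp flip: ennreal_mult')
    have IG: "(\<integral>\<^sup>+s\<in>{0<..}. ennreal (s powr (-p) * k a s) \<partial>lborel) = (\<integral>\<^sup>+s\<in>{0<..}. G s * ennreal (1 / s) \<partial>lborel)"
      unfolding G_def
      by (intro nn_integral_cong)
        (auto simp: indicator_def k_nonneg[OF a] powr_diff powr_minus field_simps simp flip: ennreal_mult')
    have FG: "F t \<le> ennreal (4 powr (p - 1) * 2 powr p) * G s" "G s \<le> ennreal (6 powr p) * F t"
      if b: "(s, t) \<in> band" for s t
    proof -
      have st: "0 < s" "0 < t" using b not_band by blast+
      have k: "0 < k a s" by (rule k_pos[OF a False st(1)])
      have "t \<le> sqrt (s * k a s)" "sqrt (s / 2 * k a (s / 2)) \<le> t" using b by (auto simp: band_def)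
      then have t2: "t\<^sup>2 \<le> s * k a s" "s / 2 * k a (s / 2) \<le> t\<^sup>2"
        using st k power_mono[of t "sqrt (s * k a s)" 2] sqrt_le_D[of "s / 2 * k a (s / 2)" t] by auto
      \<comment> \<open>The lower edge of the band controls \<open>k\<close> at \<open>s / 2\<close>
        only. Returning to \<open>s\<close> doubles \<open>k\<close>, and the halved level gives
        another 2, hence the 4 in \<open>k_le_K_functional\<close>.\<close>
      have "s * k a s \<le> s * (2 * k a (s / 2))"
        using k_scale[OF a, of "s / 2" s] st by (intro mult_left_mono) auto
      then have t3: "s * k a s \<le> 4 * t\<^sup>2" using t2 by simp
      have K: "?K t \<le> 2 * k a s" "k a s \<le> 6 * ?K t" "0 \<le> ?K t"
        using K_functional_le_k[OF a st(1)] k_le_K_functional[OF a st t3] K_functional_nonneg[OF a] t2 st by auto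
      note B = powr_interp_bounds[OF \<theta> p st k K(3) t3 t2(1) K(1,2)]
      show "F t \<le> ennreal (4 powr (p - 1) * 2 powr p) * G s" "G s \<le> ennreal (6 powr p) * F t"
        unfolding F_def G_def using B st by (simp_all add: ennreal_leI flip: ennreal_mult')
    qed
    have c: "2 * ennreal (6 powr p) = ennreal (2 * 6 powr p)" by (simp add: ennreal_mult)
    show ?thesis
      unfolding IF IG using nn_integral_le_of_band[OF _ _ FG(1)] nn_integral_ge_of_band[OF _ _ FG(2)]
      by (simp add: c)
  qed
  then show ?le ?ge by auto
qed

theorem real_interp_lp_space:
  assumes \<theta>: "0 < \<theta>" "\<theta> < 1" and p: "p = 2 / (2 - \<theta>)"
  shows "real_interp \<theta> p L1 L2 \<approx> lp_space p X u"
proof -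
  have p12: "1 < p" "p < 2" using \<theta> by (simp_all add: p divide_simps)
  obtain c where c: "0 < c" "(\<integral>\<^sup>+r\<in>{0<..}. ennreal (r powr (-p) * min 1 r) \<partial>lborel) = ennreal c"
    using nn_integral_powr_min[OF p12] .
  define C D where "C = 4 powr (p - 1) * 2 powr p" and "D = 2 * 6 powr p"
  have CD: "0 < C" "0 < D" by (auto simp: C_def D_def)
  show ?thesis
  \<comment> \<open>The integral of \<open>s powr (-p) * k a s\<close> equals \<open>c\<close> times
    the modular, so \<open>c\<close> multiplies one constant of the band comparison and divides the
    other.\<close>
  proof (rule same_spaceI[where q = p and M = "sum_space L1 L2" and I = "interp_integral \<theta> p L1 L2"
        and S = "modular p" and c = "C * c" and d = "D / c"])
    show "vecs (lp_space p X u) = {a \<in> sum_space L1 L2. modular p a < \<infinity>}"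
      using lp_subset_sum_space[OF p12] vecs_lp_iff_modular by blast
    fix a assume a: "a \<in> sum_space L1 L2"
    note b = interp_integral_bounds[OF \<theta> p a, folded C_def D_def, unfolded nn_integral_k[OF a] c(2)]
    show "interp_integral \<theta> p L1 L2 a \<le> ennreal (C * c) * modular p a"
      using b(1) CD c(1) by (simp add: ennreal_mult mult.assoc)
    have "modular p a = ennreal (1 / c) * (ennreal c * modular p a)"
      using c(1) by (simp add: mult.assoc[symmetric] flip: ennreal_mult)
    also have "\<dots> \<le> ennreal (1 / c) * (ennreal D * interp_integral \<theta> p L1 L2 a)"
      using b(2) by (rule mult_left_mono) simp
    also have "\<dots> = ennreal (D / c) * interp_integral \<theta> p L1 L2 a"
      using c(1) CD by (simp add: mult.assoc[symmetric] flip: ennreal_mult)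
    finally show "modular p a \<le> ennreal (D / c) * interp_integral \<theta> p L1 L2 a" .
  qed (use p12 c CD nrm_lp_eq_modular in \<open>auto simp: real_interp_def\<close>)
qed

end

section \<open>Application to the two biorthogonal systems\<close>

lemma biorthogonal_nonzero:
  fixes u v :: "'i \<Rightarrow> 'h::complex_hilbert"
  assumes "biorthogonal u v"
  shows "u \<xi> \<noteq> 0" "v \<xi> \<noteq> 0"
proof -
  have uv: "cinner (u \<xi>) (v \<xi>) = 1" using assms by (simp add: biorthogonal_def)
  have l: "cinner 0 y = 0" for y :: 'h using cinner_add_left[of 0 0 y] by simp
  have r: "cinner y 0 = 0" for y :: 'h using cinner_commute[of y 0] l by simp
  show "u \<xi> \<noteq> 0" "v \<xi> \<noteq> 0" using uv l r by auto
qed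

lemma complex_banach_space_nrm_pos:
  "complex_banach_space X \<Longrightarrow> x \<in> vecs X \<Longrightarrow> x \<noteq> 0 \<Longrightarrow> 0 < nrm X x"
  by (auto simp: complex_banach_space_def less_le)

theorem corollary3p4:
  fixes H :: "ennreal \<Rightarrow> ('h::complex_hilbert) nspace"
    and u v :: "'i::countable \<Rightarrow> 'h"
    and \<theta> p :: real
  assumes separable: "\<exists>D::'h set. countable D \<and> closure D = UNIV"
    and riesz: "riesz_basis u"
    and biorth: "biorthogonal u v"
    and banach: "\<And>r. 1 \<le> r \<Longrightarrow> complex_banach_space (H r)"
    and H_2: "H 2 \<approx> \<lparr>vecs = UNIV, nrm = norm\<rparr>"
    and duality: "\<And>r s x y. 1 \<le> r \<Longrightarrow> 1 \<le> s \<Longrightarrow> 1 / r + 1 / s = 1 \<Longrightarrow>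
                    x \<in> vecs (H r) \<Longrightarrow> y \<in> vecs (H s) \<Longrightarrow>
                    cmod (cinner x y) \<le> nrm (H r) x * nrm (H s) y"
    and interp_1_2: "\<And>\<tau> r. 0 < \<tau> \<Longrightarrow> \<tau> < 1 \<Longrightarrow> 1 / r = 1 - \<tau> / 2 \<Longrightarrow>
                       real_interp \<tau> r (H 1) (H 2) \<approx> H (ennreal r)"
    and interp_2_inf: "\<And>\<tau> r. 0 < \<tau> \<Longrightarrow> \<tau> < 1 \<Longrightarrow> 1 / r = (1 - \<tau>) / 2 \<Longrightarrow>
                         real_interp \<tau> r (H 2) (H \<infinity>) \<approx> H (ennreal r)"
    and u_mem: "\<And>r \<xi>. 1 \<le> r \<Longrightarrow> u \<xi> \<in> vecs (H r)"
    and v_mem: "\<And>r \<xi>. 1 \<le> r \<Longrightarrow> v \<xi> \<in> vecs (H r)"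
    and p_bounds: "1 \<le> p" "p \<le> 2"
    and theta: "0 < \<theta>" "\<theta> < 1"
    and p_theta: "p = 2 / (2 - \<theta>)"
  shows "real_interp \<theta> p (lp_space 1 (H \<infinity>) u) (lp_space 2 (H \<infinity>) u) \<approx> lp_space p (H \<infinity>) u \<and>
         real_interp \<theta> p (lp_space 1 (H \<infinity>) v) (lp_space 2 (H \<infinity>) v) \<approx> lp_space p (H \<infinity>) v"
proof -
  \<comment> \<open>Biorthogonality is symmetric enough to make every vector of either system
    nonzero, so all norms in \<open>H \<infinity>\<close> are positive weights.\<close>
  have "weighted (H \<infinity>) u" "weighted (H \<infinity>) v"
    by (unfold_locales; rule complex_banach_space_nrm_pos;
        simp add: banach u_mem v_mem biorthogonal_nonzero[OF biorth])+
  then show ?thesis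
    using weighted.real_interp_lp_space theta p_theta by blast
qed

end
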